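(* Let $\mathbb{P}$ and $\mathbb{V}$ be algebraic theories, with $\mathbb{P}$ consistent, let $T_{\mathbb{P}}$ be a stable universal set of $\mathbb{P}$-terms and $T_{\mathbb{V}}$ a stable universal set of $\mathbb{V}$-terms. Suppose there are terms $m \vdash_{\mathbb{P}} p$ and $n \vdash_{\mathbb{V}} v$ such that: (P4) there is a fixed-point free permutation $\sigma$ of $\{1,\dots,m\}$ with $m \vdash p =_{\mathbb{P}} p[\sigma]$; (P5) $1 \vdash p[1/i] =_{\mathbb{P}} 1$, where $1$ is substituted for every variable $i$; (P6) for all $p' \in T_{\mathbb{P}}$: if $\Gamma \vdash p =_{\mathbb{P}} p'$ then $m \vdash p'$; (V4) $1 \vdash v[1/i] =_{\mathbb{V}} 1$, where $1$ is substituted for every variable $i$; (V5) for all $v' \in T_{\mathbb{V}}$ and every variable $i$: if $\Gamma \vdash i =_{\mathbb{V}} v'$ then $\{i\} \vdash v'$; (V6) for all $v' \in T_{\mathbb{V}}$: if $\Gamma \vdash v =_{\mathbb{V}} v'$ then there is no variable $i \in \Gamma$ with $\{i\} \vdash v'$. Then there is no composite theory of $\mathbb{P}$ after $\mathbb{V}$.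
   Context: An algebraic theory consists of a signature and equations; $=_{\mathbb T}$ is provable equality in equational logic. Variables are natural numbers and the number $n$ also denotes $\{1,\dots,n\}$; $Y \vdash t$ means all variables of $t$ lie in $Y$; $\Gamma$ is an arbitrary variable context. $p[\sigma]$ is $p$ with each variable $i$ renamed to $\sigma(i)$. A theory is consistent if it does not prove $x=y$ for distinct variables. A set of terms is universal if every term is provably equal to a member, and stable if closed under substituting variables for variables. For theories $\mathbb{S},\mathbb{T}$ (here $\mathbb{T}=\mathbb{P}$, $\mathbb{S}=\mathbb{V}$): $\mathbb{U}$ contains them if its signature contains both signatures and their equations are provable in $\mathbb{U}$; a separated term is $t[s_x/x]$ with $t$ a $\mathbb{T}$-term with variables in $X$ and each $s_x$ an $\mathbb{S}$-term; separated terms $t[s_x/x]$, $t'[s'_{x'}/x']$ are equal modulo $(\mathbb{T},\mathbb{S})$ if there are $f:X\to Y$, $f':X'\to Y$ and $\mathbb{S}$-terms $\bar s_y$ with $t[f(x)/x]=_{\mathbb T}t'[f'(x')/x']$, $s_x=_{\mathbb S}\bar s_{f(x)}$, $s'_{x'}=_{\mathbb S}\bar s_{f'(x')}$; $\mathbb{U}$ is a composite theory of $\mathbb{T}$ after $\mathbb{S}$ if every $\mathbb U$-term is $\mathbb U$-equal to a separated term and any two separated terms $\mathbb U$-equal to a common term are equal modulo $(\mathbb{T},\mathbb{S})$. *)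

theory Defs
  imports Main "HOL-Library.FuncSet" "HOL-Combinatorics.Permutations"
begin

datatype 'f trm = Var nat | Op 'f "'f trm list"

primrec vars :: "'f trm \<Rightarrow> nat set" where
  "vars (Var x) = {x}"
| "vars (Op f ts) = \<Union> (set (map vars ts))"

primrec tsubst :: "(nat \<Rightarrow> 'f trm) \<Rightarrow> 'f trm \<Rightarrow> 'f trm" where
  "tsubst \<theta> (Var x) = \<theta> x"
| "tsubst \<theta> (Op f ts) = Op f (map (tsubst \<theta>) ts)"

definition rename :: "(nat \<Rightarrow> nat) \<Rightarrow> 'f trm \<Rightarrow> 'f trm" where
  "rename \<rho> t = tsubst (\<lambda>x. Var (\<rho> x)) t"

text \<open>
  A signature is a partial map from symbols to arities: its domain is the set of operation
  symbols. All theories under consideration draw their symbols from one arbitrary type, so that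
  inclusion of signatures is inclusion of partial maps.
\<close>

record 'f alg_theory =
  sig :: "'f \<rightharpoonup> nat"
  eqs :: "('f trm \<times> 'f trm) set"

inductive_set terms :: "'f alg_theory \<Rightarrow> 'f trm set" for T :: "'f alg_theory" where
  Var: "Var x \<in> terms T"
| Op: "\<lbrakk>sig T f = Some (length ts); \<forall>t\<in>set ts. t \<in> terms T\<rbrakk> \<Longrightarrow> Op f ts \<in> terms T"

definition algebraic_theory :: "'f alg_theory \<Rightarrow> bool" where
  "algebraic_theory T \<longleftrightarrow> eqs T \<subseteq> terms T \<times> terms T"

inductive prov_eq :: "'f alg_theory \<Rightarrow> 'f trm \<Rightarrow> 'f trm \<Rightarrow> bool" for T :: "'f alg_theory" where
  ax: "\<lbrakk>(s, t) \<in> eqs T; \<forall>x. \<theta> x \<in> terms T\<rbrakk> \<Longrightarrow> prov_eq T (tsubst \<theta> s) (tsubst \<theta> t)"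
| refl: "t \<in> terms T \<Longrightarrow> prov_eq T t t"
| sym: "prov_eq T s t \<Longrightarrow> prov_eq T t s"
| trans: "\<lbrakk>prov_eq T s t; prov_eq T t u\<rbrakk> \<Longrightarrow> prov_eq T s u"
| cong: "\<lbrakk>sig T f = Some (length ss); list_all2 (prov_eq T) ss ts\<rbrakk>
    \<Longrightarrow> prov_eq T (Op f ss) (Op f ts)"

definition term_in :: "nat set \<Rightarrow> 'f alg_theory \<Rightarrow> 'f trm \<Rightarrow> bool"
  ("(_ \<turnstile>\<^bsub>_\<^esub> _)" [51, 0, 51] 50) where
  "Y \<turnstile>\<^bsub>T\<^esub> t \<longleftrightarrow> t \<in> terms T \<and> vars t \<subseteq> Y"

definition eq_in :: "nat set \<Rightarrow> 'f alg_theory \<Rightarrow> 'f trm \<Rightarrow> 'f trm \<Rightarrow> bool"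
  ("(_ \<turnstile>\<^bsub>_\<^esub> _ \<approx> _)" [51, 0, 51, 51] 50) where
  "Y \<turnstile>\<^bsub>T\<^esub> s \<approx> t \<longleftrightarrow> Y \<turnstile>\<^bsub>T\<^esub> s \<and> Y \<turnstile>\<^bsub>T\<^esub> t \<and> prov_eq T s t"

definition consistent :: "'f alg_theory \<Rightarrow> bool" where
  "consistent T \<longleftrightarrow> (\<forall>x y. x \<noteq> y \<longrightarrow> \<not> prov_eq T (Var x) (Var y))"

definition universal_set :: "'f alg_theory \<Rightarrow> 'f trm set \<Rightarrow> bool" where
  "universal_set T A \<longleftrightarrow> A \<subseteq> terms T \<and> (\<forall>t\<in>terms T. \<exists>t'\<in>A. prov_eq T t t')"

definition stable_set :: "'f trm set \<Rightarrow> bool" where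
  "stable_set A \<longleftrightarrow> (\<forall>t\<in>A. \<forall>\<rho>. rename \<rho> t \<in> A)"

definition theory_contains :: "'f alg_theory \<Rightarrow> 'f alg_theory \<Rightarrow> bool" where
  "theory_contains U T \<longleftrightarrow> sig T \<subseteq>\<^sub>m sig U \<and> (\<forall>(l, r)\<in>eqs T. prov_eq U l r)"

text \<open>
  \<open>separated T S X t s\<close>: the data \<open>X\<close>, \<open>t\<close>, \<open>s\<close> present the separated term \<open>t[s\<^sub>x/x]\<close>,
  which is \<open>tsubst s t\<close>; the values of \<open>s\<close> outside \<open>X\<close> are irrelevant.
\<close>

definition separated ::
  "'f alg_theory \<Rightarrow> 'f alg_theory \<Rightarrow> nat set \<Rightarrow> 'f trm \<Rightarrow> (nat \<Rightarrow> 'f trm) \<Rightarrow> bool" where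
  "separated T S X t s \<longleftrightarrow> X \<turnstile>\<^bsub>T\<^esub> t \<and> (\<forall>x\<in>X. s x \<in> terms S)"

definition equal_modulo :: "'f alg_theory \<Rightarrow> 'f alg_theory \<Rightarrow>
    nat set \<Rightarrow> 'f trm \<Rightarrow> (nat \<Rightarrow> 'f trm) \<Rightarrow> nat set \<Rightarrow> 'f trm \<Rightarrow> (nat \<Rightarrow> 'f trm) \<Rightarrow> bool" where
  "equal_modulo T S X t s X' t' s' \<longleftrightarrow>
    (\<exists>Y f f' sbar. f \<in> X \<rightarrow> Y \<and> f' \<in> X' \<rightarrow> Y \<and> (\<forall>y\<in>Y. sbar y \<in> terms S) \<and>
      prov_eq T (rename f t) (rename f' t') \<and>
      (\<forall>x\<in>X. prov_eq S (s x) (sbar (f x))) \<and>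
      (\<forall>x'\<in>X'. prov_eq S (s' x') (sbar (f' x'))))"

definition composite_theory :: "'f alg_theory \<Rightarrow> 'f alg_theory \<Rightarrow> 'f alg_theory \<Rightarrow> bool" where
  "composite_theory U T S \<longleftrightarrow>
    algebraic_theory U \<and> theory_contains U T \<and> theory_contains U S \<and>
    (\<forall>u\<in>terms U. \<exists>X t s. separated T S X t s \<and> prov_eq U u (tsubst s t)) \<and>
    (\<forall>u\<in>terms U. \<forall>X t s X' t' s'.
      separated T S X t s \<and> separated T S X' t' s' \<and>
      prov_eq U (tsubst s t) u \<and> prov_eq U (tsubst s' t') u
      \<longrightarrow> equal_modulo T S X t s X' t' s')"

end

(*
  Write (k, i) for a variable coding a pair. In a composite theory U the term
  u = v[p[(k, i)/i]/k] equals a separated term p'[s_j/j], with p' and all s_j in the given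
  universal sets. If tau_k is a family of renamings with p[tau_k] = p, then renaming (k, i) to
  tau_k(i) turns u into v[p/k], which is p by idempotence of v; comparing separated terms shows
  that each renamed s_j then has at most one variable, lying in {1..m}. Renaming (k, i) to k instead turns
  u into v, by idempotence of p; comparing separated terms gives a j for which s_j contains two
  variables (k, i) and (k', i') with k and k' different. Taking tau constantly the identity forces
  i = i', and then taking tau_k the identity and every other tau equal to sigma forces
  i = sigma(i).
*)
theory Submission
  imports Defs "HOL-Library.Nat_Bijection"
begin

section \<open>Substitution and renaming\<close>

lemma tsubst_tsubst: "tsubst \<theta> (tsubst \<eta> t) = tsubst (\<lambda>x. tsubst \<theta> (\<eta> x)) t"
  by (induction t) auto

lemma tsubst_cong: "(\<And>x. x \<in> vars t \<Longrightarrow> \<theta> x = \<eta> x) \<Longrightarrow> tsubst \<theta> t = tsubst \<eta> t"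
  by (induction t) auto

lemma tsubst_Var [simp]: "tsubst Var t = t"
  by (induction t) (auto simp: map_idI)

lemma rename_tsubst: "rename \<rho> (tsubst \<theta> t) = tsubst (\<lambda>x. rename \<rho> (\<theta> x)) t"
  by (simp add: rename_def tsubst_tsubst)

lemma tsubst_rename: "tsubst \<theta> (rename \<rho> t) = tsubst (\<lambda>x. \<theta> (\<rho> x)) t"
  by (simp add: rename_def tsubst_tsubst)

lemma rename_rename: "rename \<rho> (rename \<pi> t) = rename (\<lambda>x. \<rho> (\<pi> x)) t"
  by (simp add: rename_def tsubst_tsubst)

lemma rename_cong: "(\<And>x. x \<in> vars t \<Longrightarrow> \<rho> x = \<pi> x) \<Longrightarrow> rename \<rho> t = rename \<pi> t"
  unfolding rename_def by (rule tsubst_cong) auto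

lemma rename_id [simp]: "rename (\<lambda>x. x) t = t"
  by (simp add: rename_def)

lemma rename_Var [simp]: "rename \<rho> (Var x) = Var (\<rho> x)"
  by (simp add: rename_def)

lemma vars_rename: "vars (rename \<rho> t) = \<rho> ` vars t"
  unfolding rename_def by (induction t) auto

section \<open>Closure properties of well-formed terms and provable equality\<close>

lemma tsubst_in_terms:
  assumes "t \<in> terms T" and "\<And>x. x \<in> vars t \<Longrightarrow> \<theta> x \<in> terms T"
  shows "tsubst \<theta> t \<in> terms T"
  using assms
proof (induction rule: terms.induct)
  case (Op f ts)
  then have "\<forall>t\<in>set ts. tsubst \<theta> t \<in> terms T"
    by fastforce
  with Op show ?case
    by (auto intro!: terms.Op)
qed simp

lemma rename_in_terms: "t \<in> terms T \<Longrightarrow> rename \<rho> t \<in> terms T"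
  unfolding rename_def by (rule tsubst_in_terms) (auto intro: terms.Var)

lemma prov_eq_in_terms:
  assumes "algebraic_theory T" and "prov_eq T s t"
  shows "s \<in> terms T \<and> t \<in> terms T"
  using assms(2)
proof (induction rule: prov_eq.induct)
  case (ax s t \<theta>)
  then show ?case
    using assms(1) by (auto simp: algebraic_theory_def intro!: tsubst_in_terms)
next
  case (cong f ss ts)
  then have "length ss = length ts"
    by (auto dest: list_all2_lengthD)
  with cong show ?case
    by (auto intro!: terms.Op simp: list_all2_conv_all_nth in_set_conv_nth)
qed auto

declare prov_eq.trans [trans]

lemma prov_eq_join: "prov_eq T s t \<Longrightarrow> prov_eq T u t \<Longrightarrow> prov_eq T s u"
  by (rule prov_eq.trans[OF _ prov_eq.sym])

lemma prov_eq_tsubst: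
  assumes "prov_eq T s t" and "\<And>x. \<theta> x \<in> terms T"
  shows "prov_eq T (tsubst \<theta> s) (tsubst \<theta> t)"
  using assms(1)
proof (induction rule: prov_eq.induct)
  case (ax s t \<eta>)
  then have "prov_eq T (tsubst (\<lambda>x. tsubst \<theta> (\<eta> x)) s) (tsubst (\<lambda>x. tsubst \<theta> (\<eta> x)) t)"
    using assms(2) by (intro prov_eq.ax) (auto intro: tsubst_in_terms)
  then show ?case
    by (simp add: tsubst_tsubst)
next
  case (refl t)
  then show ?case
    using assms(2) by (auto intro!: prov_eq.refl tsubst_in_terms)
next
  case (cong f ss ts)
  then show ?case
    by (auto intro!: prov_eq.cong simp: list_all2_conv_all_nth)
qed (blast intro: prov_eq.sym prov_eq.trans)+

lemma prov_eq_rename: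
  "prov_eq T s t \<Longrightarrow> prov_eq T (rename \<rho> s) (rename \<rho> t)"
  unfolding rename_def by (rule prov_eq_tsubst) (auto intro: terms.Var)

lemma prov_eq_tsubst_cong:
  assumes "t \<in> terms T" and "\<And>x. x \<in> vars t \<Longrightarrow> prov_eq T (\<theta> x) (\<eta> x)"
  shows "prov_eq T (tsubst \<theta> t) (tsubst \<eta> t)"
  using assms
proof (induction rule: terms.induct)
  case (Op f ts)
  then have "\<forall>t\<in>set ts. prov_eq T (tsubst \<theta> t) (tsubst \<eta> t)"
    by fastforce
  with Op show ?case
    by (auto intro!: prov_eq.cong simp: list_all2_conv_all_nth)
qed simp

section \<open>Passage to a containing theory\<close>

lemma terms_mono:
  assumes "theory_contains U T" and "t \<in> terms T"
  shows "t \<in> terms U"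
  using assms(2,1)
  by (induction rule: terms.induct)
     (auto intro!: terms.intros simp: theory_contains_def map_le_def dom_def)

lemma prov_eq_mono:
  assumes "theory_contains U T" and "prov_eq T s t"
  shows "prov_eq U s t"
  using assms(2)
proof (induction rule: prov_eq.induct)
  case (ax s t \<theta>)
  \<comment> \<open>Equations of \<open>T\<close> are only provable in \<open>U\<close>, not axioms
    there, so their instances come from closure of provability under substitution.\<close>
  then have "prov_eq U s t" "\<And>x. \<theta> x \<in> terms U"
    using assms(1) terms_mono[OF assms(1)] by (auto simp: theory_contains_def)
  then show ?case
    by (rule prov_eq_tsubst)
next
  case (refl t)
  then show ?case
    using assms(1) by (blast intro: prov_eq.refl terms_mono)
next
  case (cong f ss ts)
  then have "sig U f = Some (length ss)"
    using assms(1) by (auto simp: theory_contains_def map_le_def dom_def)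
  with cong show ?case
    by (auto intro!: prov_eq.cong simp: list_all2_conv_all_nth)
qed (blast intro: prov_eq.sym prov_eq.trans)+

section \<open>Representing and comparing separated terms\<close>

lemma composite_separation:
  assumes comp: "composite_theory U T S"
    and A: "universal_set T A" and B: "universal_set S B"
    and u: "u \<in> terms U"
  obtains t s where "t \<in> A" and "\<And>x. s x \<in> B" and "prov_eq U u (tsubst s t)"
proof -
  have UT: "theory_contains U T" and US: "theory_contains U S"
    using comp by (auto simp: composite_theory_def)
  obtain X t s where sep: "separated T S X t s" and us: "prov_eq U u (tsubst s t)"
    using comp u unfolding composite_theory_def by meson
  have B': "b \<in> terms U" if "b \<in> B" for b
    using B that terms_mono[OF US] by (auto simp: universal_set_def)
  have t: "t \<in> terms T" "vars t \<subseteq> X" and s: "\<And>x. x \<in> X \<Longrightarrow> s x \<in> terms S"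
    using sep by (auto simp: separated_def term_in_def)
  \<comment> \<open>Outside \<open>X\<close> the value \<open>s x\<close> need not be an
    \<open>S\<close>-term; any member of \<open>B\<close> serves there, and a representative of
    \<open>Var x\<close> shows that one exists.\<close>
  have "\<exists>b\<in>B. x \<in> X \<longrightarrow> prov_eq S (s x) b" for x
    using B s[of x] terms.Var[of x S] unfolding universal_set_def by (cases "x \<in> X") blast+
  then obtain b where b: "\<And>x. b x \<in> B" "\<And>x. x \<in> X \<Longrightarrow> prov_eq S (s x) (b x)"
    by metis
  obtain a where a: "a \<in> A" "prov_eq T t a"
    using A t unfolding universal_set_def by blast
  have "prov_eq U (tsubst s t) (tsubst b t)"
    using b(2) t(2)
    by (intro prov_eq_tsubst_cong[OF terms_mono[OF UT t(1)]] prov_eq_mono[OF US]) blast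
  \<comment> \<open>The representative \<open>a\<close> may have variables outside \<open>X\<close>,
    which is why \<open>b\<close> was chosen in \<open>B\<close> at every variable.\<close>
  moreover have "prov_eq U (tsubst b t) (tsubst b a)"
    using a(2) b(1) by (intro prov_eq_tsubst prov_eq_mono[OF UT] B')
  ultimately show ?thesis
    using that a(1) b(1) us by (blast intro: prov_eq.trans)
qed

text \<open>Each outer term is presented over exactly its own variables, and the right-hand side
  itself serves as the common term \<open>u\<close> of the definition.\<close>

lemma composite_uniqueness:
  assumes comp: "composite_theory U T S"
    and t: "t \<in> terms T" "t' \<in> terms T"
    and s: "\<And>x. s x \<in> terms S" "\<And>x. s' x \<in> terms S"
    and eq: "prov_eq U (tsubst s t) (tsubst s' t')"
  obtains f f' sbar where "prov_eq T (rename f t) (rename f' t')"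
    and "\<And>x. x \<in> vars t \<Longrightarrow> prov_eq S (s x) (sbar (f x))"
    and "\<And>x. x \<in> vars t' \<Longrightarrow> prov_eq S (s' x) (sbar (f' x))"
proof -
  have "algebraic_theory U"
    using comp by (simp add: composite_theory_def)
  then have u: "tsubst s' t' \<in> terms U"
    using eq prov_eq_in_terms by blast
  have "separated T S (vars t) t s" "separated T S (vars t') t' s'"
    using t s by (auto simp: separated_def term_in_def)
  then have "equal_modulo T S (vars t) t s (vars t') t' s'"
    using comp u eq prov_eq.refl[OF u] unfolding composite_theory_def by blast
  then show ?thesis
    using that unfolding equal_modulo_def by blast
qed

text \<open>If \<open>y\<close> did not occur in \<open>t\<close>, renaming \<open>y\<close> to
  \<open>Suc y\<close> would fix \<open>t\<close> but move the right-hand side, so two distinct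
  variables would be provably equal.\<close>

lemma consistent_var_in_vars:
  assumes "consistent T" and eq: "prov_eq T t (Var y)"
  shows "y \<in> vars t"
proof (rule ccontr)
  assume "y \<notin> vars t"
  let ?\<rho> = "\<lambda>x. if x = y then Suc y else x"
  have "rename ?\<rho> t = rename (\<lambda>x. x) t"
    using \<open>y \<notin> vars t\<close> by (intro rename_cong) auto
  then have "prov_eq T t (Var (Suc y))"
    using prov_eq_rename[OF eq, of ?\<rho>] by simp
  then have "prov_eq T (Var y) (Var (Suc y))"
    using eq prov_eq.sym prov_eq.trans by blast
  then show False
    using assms(1) unfolding consistent_def by (metis n_not_Suc_n)
qed

section \<open>A fixed point of the permutation from a composite theory\<close>

theorem theorem3p13:
  fixes P V :: "'f alg_theory"
    and T\<^sub>P T\<^sub>V :: "'f trm set"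
    and m n :: nat
    and p v :: "'f trm"
  assumes "algebraic_theory P" and "algebraic_theory V"
    and "consistent P"
    and "universal_set P T\<^sub>P" and "stable_set T\<^sub>P"
    and "universal_set V T\<^sub>V" and "stable_set T\<^sub>V"
    and "{1..m} \<turnstile>\<^bsub>P\<^esub> p" and "{1..n} \<turnstile>\<^bsub>V\<^esub> v"
    and P4: "\<exists>\<sigma>. \<sigma> permutes {1..m} \<and> (\<forall>i\<in>{1..m}. \<sigma> i \<noteq> i) \<and> {1..m} \<turnstile>\<^bsub>P\<^esub> p \<approx> rename \<sigma> p"
    and P5: "{1} \<turnstile>\<^bsub>P\<^esub> rename (\<lambda>i. 1) p \<approx> Var 1"
    and P6: "\<forall>p'\<in>T\<^sub>P. \<forall>\<Gamma>. \<Gamma> \<turnstile>\<^bsub>P\<^esub> p \<approx> p' \<longrightarrow> {1..m} \<turnstile>\<^bsub>P\<^esub> p'"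
    and V4: "{1} \<turnstile>\<^bsub>V\<^esub> rename (\<lambda>i. 1) v \<approx> Var 1"
    and V5: "\<forall>v'\<in>T\<^sub>V. \<forall>i \<Gamma>. \<Gamma> \<turnstile>\<^bsub>V\<^esub> Var i \<approx> v' \<longrightarrow> {i} \<turnstile>\<^bsub>V\<^esub> v'"
    and V6: "\<forall>v'\<in>T\<^sub>V. \<forall>\<Gamma>. \<Gamma> \<turnstile>\<^bsub>V\<^esub> v \<approx> v' \<longrightarrow> \<not> (\<exists>i\<in>\<Gamma>. {i} \<turnstile>\<^bsub>V\<^esub> v')"
  shows "\<not> (\<exists>U :: 'f alg_theory. composite_theory U P V)"
proof
  assume "\<exists>U :: 'f alg_theory. composite_theory U P V"
  then obtain U :: "'f alg_theory" where comp: "composite_theory U P V" ..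
  have UP: "theory_contains U P" and UV: "theory_contains U V"
    using comp by (auto simp: composite_theory_def)
  have TP: "t \<in> terms P" if "t \<in> T\<^sub>P" for t
    using that assms(4) by (auto simp: universal_set_def)
  have TV: "t \<in> terms V" if "t \<in> T\<^sub>V" for t
    using that assms(6) by (auto simp: universal_set_def)
  have p: "p \<in> terms P" "vars p \<subseteq> {1..m}" and v: "v \<in> terms V"
    using assms(8,9) by (auto simp: term_in_def)
  have pU: "rename \<rho> p \<in> terms U" for \<rho>
    using p(1) by (intro terms_mono[OF UP] rename_in_terms)
  have vU: "v \<in> terms U"
    using v by (rule terms_mono[OF UV])
  obtain \<sigma> where \<sigma>: "\<And>i. i \<in> {1..m} \<Longrightarrow> \<sigma> i \<noteq> i" and p\<sigma>: "prov_eq P p (rename \<sigma> p)"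
    using P4 unfolding eq_in_def by blast
  have p_idem: "prov_eq P (rename (\<lambda>_. k) p) (Var k)" for k
    using P5 prov_eq_rename[of P "rename (\<lambda>i. 1) p" "Var 1" "\<lambda>_. k"]
    by (simp add: eq_in_def rename_rename)
  have v_idem: "prov_eq V (rename (\<lambda>i. 1) v) (Var 1)"
    using V4 by (simp add: eq_in_def)
  have V5': "vars v' \<subseteq> {i}" if "v' \<in> T\<^sub>V" "prov_eq V (Var i) v'" for v' i
    using V5[rule_format, OF that(1), of "insert i (vars v')" i] that TV[OF that(1)]
    by (auto simp: eq_in_def term_in_def terms.Var)
  \<comment> \<open>V6 excludes only variables of the context, so \<open>i\<close> is put into it by
    hand.\<close>
  have V6': "\<not> vars v' \<subseteq> {i}" if "v' \<in> T\<^sub>V" "prov_eq V v v'" for v' i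
    using V6[rule_format, OF that(1), of "insert i (vars v \<union> vars v')"] that TV[OF that(1)] v
    by (auto simp: eq_in_def term_in_def)
  \<comment> \<open>In an inconsistent \<open>V\<close> all terms are equal. A representative of
    \<open>v\<close> would then equal \<open>Var 1\<close>, so V5 would leave it at most the
    variable 1, which V6 forbids.\<close>
  have V_consistent: "consistent V"
    unfolding consistent_def
  proof (intro allI impI notI)
    fix x y :: nat
    assume "x \<noteq> y" and xy: "prov_eq V (Var x) (Var y)"
    obtain v' where v': "v' \<in> T\<^sub>V" "prov_eq V v v'"
      using assms(6) v by (auto simp: universal_set_def)
    let ?\<theta> = "\<lambda>z. if z = x then Var 1 else v'"
    have "prov_eq V (tsubst ?\<theta> (Var x)) (tsubst ?\<theta> (Var y))"
      using TV[OF v'(1)] by (intro prov_eq_tsubst[OF xy]) (auto intro: terms.Var)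
    then have "vars v' \<subseteq> {1}"
      using \<open>x \<noteq> y\<close> by (intro V5' v') simp
    with V6'[OF v'] show False
      by blast
  qed

  define u where "u = tsubst (\<lambda>k. rename (\<lambda>i. prod_encode (k, i)) p) v"
  have "u \<in> terms U"
    unfolding u_def using vU pU by (rule tsubst_in_terms)
  then obtain p' s where p': "p' \<in> T\<^sub>P" and s: "\<And>j. s j \<in> T\<^sub>V"
    and u: "prov_eq U u (tsubst s p')"
    using composite_separation[OF comp assms(4,6)] by metis
  have s_rename: "rename \<rho> (s j) \<in> T\<^sub>V" for \<rho> j
    using assms(7) s by (simp add: stable_set_def)

  \<comment> \<open>The data \<open>p'\<close> and \<open>s\<close> are fixed before
    \<open>\<tau>\<close>, so different families can be tested on the same
    \<open>s j\<close>.\<close>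
  have one_var: "\<exists>i\<in>{1..m}. \<forall>x\<in>vars (s j). case_prod \<tau> (prod_decode x) = i"
    if \<tau>: "\<And>k. prov_eq P (rename (\<tau> k) p) p" and j: "j \<in> vars p'" for \<tau> j
  proof -
    define f where "f = (\<lambda>x. case_prod \<tau> (prod_decode x))"
    have "prov_eq U (tsubst (\<lambda>j. rename f (s j)) p') (rename f u)"
      using prov_eq.sym[OF prov_eq_rename[OF u]] by (simp add: rename_tsubst)
    also have "prov_eq U (rename f u) (tsubst (\<lambda>_. p) v)"
      using \<tau> unfolding u_def f_def rename_tsubst rename_rename
      by (intro prov_eq_tsubst_cong[OF vU] prov_eq_mono[OF UP]) simp
    \<comment> \<open>This is \<open>v_idem\<close> with \<open>p\<close> substituted for variable
      1. The form \<open>tsubst Var p\<close> presents \<open>p\<close> as a separated term whose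
      inner terms are variables.\<close>
    also have "prov_eq U (tsubst (\<lambda>_. p) v) (tsubst Var p)"
      using prov_eq_tsubst[OF prov_eq_mono[OF UV v_idem], of "\<lambda>_. p"] terms_mono[OF UP p(1)]
      by (simp add: tsubst_rename)
    finally have "prov_eq U (tsubst (\<lambda>j. rename f (s j)) p') (tsubst Var p)" .
    from composite_uniqueness[OF comp TP[OF p'] p(1) TV[OF s_rename] terms.Var this]
    obtain g g' sbar where gg': "prov_eq P (rename g p') (rename g' p)"
      and g: "\<And>x. x \<in> vars p' \<Longrightarrow> prov_eq V (rename f (s x)) (sbar (g x))"
      and g': "\<And>x. x \<in> vars p \<Longrightarrow> prov_eq V (Var x) (sbar (g' x))"
      by blast
    \<comment> \<open>Variables of \<open>p\<close> identified by \<open>g'\<close> share one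
      \<open>sbar\<close>, hence would be provably equal in \<open>V\<close>.\<close>
    have inj: "inj_on g' (vars p)"
    proof (rule inj_onI, rule ccontr)
      fix x y
      assume "x \<in> vars p" "y \<in> vars p" "g' x = g' y" "x \<noteq> y"
      then have "prov_eq V (Var x) (Var y)"
        using prov_eq_join[OF g'[of x]] g'[of y] by simp
      with \<open>x \<noteq> y\<close> V_consistent show False
        by (simp add: consistent_def)
    qed
    \<comment> \<open>A left inverse of \<open>g'\<close> sending everything else to \<open>0\<close>, which is not in \<open>{1..m}\<close>.\<close>
    define h where "h = (\<lambda>y. if y \<in> g' ` vars p then inv_into (vars p) g' y else 0)"
    have "rename h (rename g' p) = rename (\<lambda>x. x) p"
      unfolding rename_rename using inj by (intro rename_cong) (auto simp: h_def)
    then have "prov_eq P p (rename (\<lambda>x. h (g x)) p')"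
      using prov_eq_rename[OF gg', of h] by (simp add: rename_rename prov_eq.sym)
    \<comment> \<open>Stability keeps the renamed \<open>p'\<close> in the universal set, so P6
      applies to it.\<close>
    moreover have "rename (\<lambda>x. h (g x)) p' \<in> T\<^sub>P"
      using assms(5) p' by (simp add: stable_set_def)
    ultimately have "vars (rename (\<lambda>x. h (g x)) p') \<subseteq> {1..m}"
      using P6[rule_format, of _ "vars p \<union> vars (rename (\<lambda>x. h (g x)) p')"] TP p(1)
      by (auto simp: eq_in_def term_in_def)
    then have "h (g j) \<in> {1..m}"
      using j by (auto simp: vars_rename)
    \<comment> \<open>P6 has ruled out the default value 0 of \<open>h\<close>, so
      \<open>g j\<close> lies in the image of \<open>g'\<close>.\<close>
    then obtain i where i: "i \<in> vars p" "g j = g' i"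
      by (auto simp: h_def split: if_splits)
    then have "prov_eq V (Var i) (rename f (s j))"
      using prov_eq_join[OF g'[of i]] g[OF j] by simp
    then have "vars (rename f (s j)) \<subseteq> {i}"
      by (rule V5'[OF s_rename])
    then show ?thesis
      using i(1) p(2) unfolding vars_rename f_def by blast
  qed

  define f where "f = (\<lambda>x. fst (prod_decode x))"
  have "prov_eq U (tsubst (\<lambda>j. rename f (s j)) p') (rename f u)"
    using prov_eq.sym[OF prov_eq_rename[OF u]] by (simp add: rename_tsubst)
  also have "prov_eq U (rename f u) (tsubst Var v)"
    unfolding u_def rename_tsubst rename_rename f_def
    using p_idem by (intro prov_eq_tsubst_cong[OF vU] prov_eq_mono[OF UP]) simp
  \<comment> \<open>Now \<open>v\<close> is presented with a single variable as outer term, so that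
    all of \<open>v\<close> is one inner term.\<close>
  finally have "prov_eq U (tsubst (\<lambda>j. rename f (s j)) p') (tsubst (\<lambda>_. v) (Var 1))"
    by simp
  from composite_uniqueness[OF comp TP[OF p'] terms.Var TV[OF s_rename] v this]
  obtain g g' sbar where gg': "prov_eq P (rename g p') (rename g' (Var 1))"
    and g: "\<And>x. x \<in> vars p' \<Longrightarrow> prov_eq V (rename f (s x)) (sbar (g x))"
    and g': "\<And>x. x \<in> vars (Var 1 :: 'f trm) \<Longrightarrow> prov_eq V v (sbar (g' x))"
    by blast
  \<comment> \<open>The renamed \<open>p'\<close> equals a variable, which must occur in it by
    consistency of \<open>P\<close>; this yields a \<open>j\<close> whose inner term matches
    \<open>v\<close>.\<close>
  have "g' 1 \<in> vars (rename g p')"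
    using gg' by (intro consistent_var_in_vars[OF assms(3)]) simp
  then obtain j where j: "j \<in> vars p'" "g j = g' 1"
    by (auto simp: vars_rename)
  then have vj: "prov_eq V v (rename f (s j))"
    using prov_eq_join[OF g'[of 1]] g[OF j(1)] by simp

  \<comment> \<open>This holds for every \<open>k\<close>, so \<open>s j\<close> has a variable at
    all, and another one with a different first component.\<close>
  have two_vars: "\<not> f ` vars (s j) \<subseteq> {k}" for k
    using V6'[OF s_rename vj] by (simp add: vars_rename)
  obtain x where x: "x \<in> vars (s j)"
    using two_vars by blast
  obtain y where y: "y \<in> vars (s j)" "f y \<noteq> f x"
    using two_vars[of "f x"] by blast
  have "prov_eq P (rename (\<lambda>i. i) p) p"
    using p(1) by (simp add: prov_eq.refl)
  then obtain i where i: "i \<in> {1..m}" "\<forall>z\<in>vars (s j). snd (prod_decode z) = i"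
    using one_var[of "\<lambda>_ i. i", OF _ j(1)] by (auto simp: case_prod_unfold)
  \<comment> \<open>The variables \<open>x\<close> and \<open>y\<close> share the second component
    \<open>i\<close>, but only \<open>x\<close> lies in the copy of \<open>p\<close> left fixed;
    equal images would give \<open>i = \<sigma> i\<close>.\<close>
  define \<tau> where "\<tau> = (\<lambda>k. if k = f x then (\<lambda>i. i) else \<sigma>)"
  have "prov_eq P (rename (\<tau> k) p) p" for k
    using p(1) p\<sigma> by (simp add: \<tau>_def prov_eq.refl prov_eq.sym)
  then obtain i' where "\<forall>z\<in>vars (s j). \<tau> (f z) (snd (prod_decode z)) = i'"
    using one_var[of \<tau>, OF _ j(1)] by (auto simp: case_prod_unfold f_def)
  then have "\<tau> (f x) i = \<tau> (f y) i"
    using x y(1) i(2) by metis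
  then show False
    using y(2) \<sigma>[OF i(1)] by (simp add: \<tau>_def)
qed

end
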